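(* Let $k\ge 2$ and let $\mathcal{H}=(V,\mathcal{E})$ be a $k$-uniform 2-hypertree with $n=|V|$. For $i\ge 1$ let $C_i$ be the number of maximal stars of $\mathcal{H}$ having exactly $i$ edges, and let $l$ be the number of $(k-1)$-subsets of $V$ not contained in any edge of $\mathcal{H}$. Then $$|\mathcal{E}|=\frac{1}{k-1}\binom{n}{k-1}-\frac{1}{k-1}\sum_{i=1}^{n-k+1}C_i-\frac{l}{k-1}.$$
   Context: A $k$-uniform hypergraph $\mathcal{H}=(V,\mathcal{E})$ consists of a finite vertex set $V$ and a set $\mathcal{E}$ of $k$-element subsets of $V$ (no multiple edges). A $k$-uniform hypergraph is a chain if there is a sequence $v_1,\dots,v_l$ of its vertices in which every vertex appears at least once (possibly more times), $v_1\ne v_l$, and its edge set consists of exactly the $l-k+1$ distinct sets $\{v_i,\dots,v_{i+k-1}\}$, $1\le i\le l-k+1$; it is a semicycle if the same holds with $v_1=v_l$ instead. The length of a chain is its number of edges. $\mathcal{H}$ is chain-connected if every pair of distinct vertices is contained in some subhypergraph that is a chain; semicycle-free if no subhypergraph is a semicycle. A hypertree is a chain-connected, semicycle-free $k$-uniform hypergraph; a 2-hypertree is a hypertree in which every chain (subhypergraph) has length at most 2. A star of $\mathcal{H}$ is a nonempty set $S\subseteq\mathcal{E}$ of edges all containing a common $(k-1)$-set (i.e. $|\bigcap S|\ge k-1$); a maximal star is a star not properly contained in another star of $\mathcal{H}$. *)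

theory Defs
  imports Complex_Main
begin

text \<open>A hypergraph is given by its vertex set \<open>V\<close> and its edge set \<open>E\<close>.\<close>

definition uniform_hypergraph :: "nat \<Rightarrow> 'a set \<Rightarrow> 'a set set \<Rightarrow> bool" where
  "uniform_hypergraph k V E \<longleftrightarrow> finite V \<and> (\<forall>e\<in>E. e \<subseteq> V \<and> card e = k)"

definition subhypergraph :: "nat \<Rightarrow> 'a set \<Rightarrow> 'a set set \<Rightarrow> 'a set \<Rightarrow> 'a set set \<Rightarrow> bool" where
  "subhypergraph k V' E' V E \<longleftrightarrow> uniform_hypergraph k V' E' \<and> V' \<subseteq> V \<and> E' \<subseteq> E"

text \<open>With the sequence \<open>v\<^sub>1, \<dots>, v\<^sub>l\<close> as a list, \<open>window k vs i\<close> is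
  \<open>{v\<^bsub>i+1\<^esub>, \<dots>, v\<^bsub>i+k\<^esub>}\<close> (the index \<open>i\<close> counts from 0).\<close>

definition window :: "nat \<Rightarrow> 'a list \<Rightarrow> nat \<Rightarrow> 'a set" where
  "window k vs i = {vs ! j | j. i \<le> j \<and> j < i + k}"

text \<open>The condition \<open>k \<le> length vs\<close> says that there is at least one edge. Without it, for
  \<open>k \<ge> 3\<close>, any two vertices would form an edgeless chain, and for \<open>k \<ge> 2\<close> a
  single vertex would be a semicycle. Injectivity makes the \<open>l - k + 1\<close> windows distinct.\<close>

definition traces :: "nat \<Rightarrow> 'a set \<Rightarrow> 'a set set \<Rightarrow> 'a list \<Rightarrow> bool" where
  "traces k V E vs \<longleftrightarrow> k \<le> length vs \<and> set vs = V \<and>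
     E = window k vs ` {..length vs - k} \<and> inj_on (window k vs) {..length vs - k}"

definition is_chain :: "nat \<Rightarrow> 'a set \<Rightarrow> 'a set set \<Rightarrow> bool" where
  "is_chain k V E \<longleftrightarrow> uniform_hypergraph k V E \<and> (\<exists>vs. traces k V E vs \<and> hd vs \<noteq> last vs)"

definition is_semicycle :: "nat \<Rightarrow> 'a set \<Rightarrow> 'a set set \<Rightarrow> bool" where
  "is_semicycle k V E \<longleftrightarrow> uniform_hypergraph k V E \<and> (\<exists>vs. traces k V E vs \<and> hd vs = last vs)"

definition chain_connected :: "nat \<Rightarrow> 'a set \<Rightarrow> 'a set set \<Rightarrow> bool" where
  "chain_connected k V E \<longleftrightarrow>
     (\<forall>u\<in>V. \<forall>v\<in>V. u \<noteq> v \<longrightarrow>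
        (\<exists>V' E'. subhypergraph k V' E' V E \<and> is_chain k V' E' \<and> u \<in> V' \<and> v \<in> V'))"

definition semicycle_free :: "nat \<Rightarrow> 'a set \<Rightarrow> 'a set set \<Rightarrow> bool" where
  "semicycle_free k V E \<longleftrightarrow> \<not> (\<exists>V' E'. subhypergraph k V' E' V E \<and> is_semicycle k V' E')"

definition hypertree :: "nat \<Rightarrow> 'a set \<Rightarrow> 'a set set \<Rightarrow> bool" where
  "hypertree k V E \<longleftrightarrow> uniform_hypergraph k V E \<and> chain_connected k V E \<and> semicycle_free k V E"

definition two_hypertree :: "nat \<Rightarrow> 'a set \<Rightarrow> 'a set set \<Rightarrow> bool" where
  "two_hypertree k V E \<longleftrightarrow> hypertree k V E \<and>
     (\<forall>V' E'. subhypergraph k V' E' V E \<and> is_chain k V' E' \<longrightarrow> card E' \<le> 2)"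

definition is_star :: "nat \<Rightarrow> 'a set set \<Rightarrow> 'a set set \<Rightarrow> bool" where
  "is_star k E S \<longleftrightarrow> S \<noteq> {} \<and> S \<subseteq> E \<and> (\<exists>T. finite T \<and> card T = k - 1 \<and> (\<forall>e\<in>S. T \<subseteq> e))"

definition maximal_star :: "nat \<Rightarrow> 'a set set \<Rightarrow> 'a set set \<Rightarrow> bool" where
  "maximal_star k E S \<longleftrightarrow> is_star k E S \<and> \<not> (\<exists>S'. is_star k E S' \<and> S \<subset> S')"

definition num_maximal_stars :: "nat \<Rightarrow> 'a set set \<Rightarrow> nat \<Rightarrow> nat" where
  "num_maximal_stars k E i = card {S. maximal_star k E S \<and> card S = i}"

definition num_uncovered :: "nat \<Rightarrow> 'a set \<Rightarrow> 'a set set \<Rightarrow> nat" where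
  "num_uncovered k V E = card {T. T \<subseteq> V \<and> card T = k - 1 \<and> \<not> (\<exists>e\<in>E. T \<subseteq> e)}"

end

theory Submission imports Defs begin

text \<open>
  Two different \<open>(k - 1)\<close>-subsets of an edge \<open>e\<close> cannot both lie in further edges: these would
  form with \<open>e\<close> a chain of length 3 or a semicycle. So every edge \<open>e\<close> has a \<open>(k - 1)\<close>-subset
  \<open>t e\<close> such that all its other \<open>(k - 1)\<close>-subsets lie in no edge but \<open>e\<close>. The maximal stars are
  then the sets of all edges through some \<open>t e\<close>, and the covered \<open>(k - 1)\<close>-sets are the sets
  \<open>t e\<close>, one for each maximal star, together with \<open>k - 1\<close> private ones for every edge.
\<close>

section \<open>Preliminaries on stars, windows and facets, the \<open>(k - 1)\<close>-subsets of
  edges\<close>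

text \<open>The equation \<open>star_at E T = {e}\<close> is the form in which the proof says that
  \<open>T\<close> is private to \<open>e\<close>.\<close>

definition star_at :: "'a set set \<Rightarrow> 'a set \<Rightarrow> 'a set set" where
  "star_at E T = {e \<in> E. T \<subseteq> e}"

text \<open>In this form the windows of an explicitly given list can be computed by
  simplification.\<close>

lemma window_eq_set_take_drop:
  assumes "i + k \<le> length vs"
  shows "window k vs i = set (take k (drop i vs))"
proof -
  have "window k vs i = (!) vs ` (+) i ` {0..<k}"
    unfolding image_add_atLeastLessThan by (auto simp: window_def add.commute)
  also have "\<dots> = (!) (drop i vs) ` {0..<k}"
    using assms by (simp add: image_image del: image_add_atLeastLessThan)
  also have "\<dots> = set (take k (drop i vs))"
    using assms by (intro nth_image) simp
  finally show ?thesis .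
qed

lemma insert_of_Suc_card:
  assumes "T \<subseteq> e" "finite e" "card e = Suc (card T)"
  obtains x where "x \<notin> T" "e = insert x T"
proof -
  have "card (e - T) = 1"
    using assms by (simp add: card_Diff_subset finite_subset)
  then obtain x where "e - T = {x}" by (auto simp: card_1_singleton_iff)
  then show ?thesis using assms(1) that[of x] by blast
qed

section \<open>Shared and private facets of an edge\<close>

text \<open>If \<open>T1\<close> and \<open>T2\<close> differ, the vertices can be ordered so that
  \<open>e1\<close>, \<open>e\<close>, \<open>e2\<close> are consecutive windows with overlaps
  \<open>T1\<close> and \<open>T2\<close>.\<close>

lemma two_hypertree_shared_facet_unique:
  assumes k: "k \<ge> 2" and H: "two_hypertree k V E"
    and E: "e \<in> E" "e1 \<in> E" "e2 \<in> E" "e1 \<noteq> e" "e2 \<noteq> e"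
    and T1: "T1 \<subseteq> e" "T1 \<subseteq> e1" "card T1 = k - 1"
    and T2: "T2 \<subseteq> e" "T2 \<subseteq> e2" "card T2 = k - 1"
  shows "T1 = T2"
proof (rule ccontr)
  assume "T1 \<noteq> T2"
  have U: "uniform_hypergraph k V E"
    using H by (simp add: two_hypertree_def hypertree_def)
  have fin: "finite f" and card_edge: "card f = k" and sub: "f \<subseteq> V" if "f \<in> E" for f
    using U that by (auto simp: uniform_hypergraph_def intro: finite_subset)
  obtain x where x: "x \<notin> T1" "e = insert x T1"
    using insert_of_Suc_card[of T1 e] fin card_edge E T1 k by auto
  obtain y where y: "y \<notin> T2" "e = insert y T2"
    using insert_of_Suc_card[of T2 e] fin card_edge E T2 k by auto
  obtain a where a: "a \<notin> T1" "e1 = insert a T1"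
    using insert_of_Suc_card[of T1 e1] fin card_edge E T1 k by auto
  obtain b where b: "b \<notin> T2" "e2 = insert b T2"
    using insert_of_Suc_card[of T2 e2] fin card_edge E T2 k by auto
  have xy: "x \<noteq> y" using x y \<open>T1 \<noteq> T2\<close> by (metis insert_ident)
  have ae: "a \<notin> e" using a x E by auto
  \<comment> \<open>\<open>R\<close> is the intersection of \<open>T1\<close> and \<open>T2\<close>.
    Its vertices lie in all three edges, so any order of them serves.\<close>
  define R where "R = e - {x, y}"
  have "x \<in> e" "y \<in> e" using x y by blast+
  then have "card R = k - 2"
    using fin[OF E(1)] card_edge[OF E(1)] xy by (simp add: R_def card_Diff_subset)
  moreover obtain r where r: "set r = R" "distinct r"
    using finite_distinct_list fin[OF E(1)] by (metis R_def finite_Diff)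
  ultimately have len_r: "length r = k - 2" using distinct_card by fastforce
  obtain m where m: "k = Suc (Suc m)" using k by (metis add_2_eq_Suc le_Suc_ex)
  \<comment> \<open>traces a chain with 3 edges if \<open>a \<noteq> b\<close> and a semicycle if \<open>a = b\<close>\<close>
  define vs where "vs = a # y # r @ [x, b]"
  have len: "length vs = k + 2" using len_r m by (simp add: vs_def)
  have e_eq: "e = insert y (insert x R)"
    using \<open>x \<in> e\<close> \<open>y \<in> e\<close> by (auto simp: R_def)
  have "T1 = e - {x}" using x by simp
  then have "T1 = insert y R" using \<open>y \<in> e\<close> xy by (auto simp: R_def)
  moreover have "T2 = e - {y}" using y by simp
  then have "T2 = insert x R" using \<open>x \<in> e\<close> xy by (auto simp: R_def)
  ultimately have e1_eq: "e1 = insert a (insert y R)" and e2_eq: "e2 = insert x (insert b R)"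
    using a b by (simp_all add: insert_commute)
  have w0: "window k vs 0 = e1" and w1: "window k vs 1 = e" and w2: "window k vs 2 = e2"
    using len_r r m e_eq e1_eq e2_eq
    by (simp_all add: window_eq_set_take_drop len, simp_all add: vs_def insert_commute)
  \<comment> \<open>The edges have to be distinct even when \<open>a = b\<close>. The vertex
    \<open>x\<close> separates them: it belongs to \<open>T2\<close>, but it is not in
    \<open>T1\<close>, and it is not \<open>a\<close>, which lies outside \<open>e\<close>.\<close>
  have ne: "e1 \<noteq> e2"
  proof -
    have "x \<in> e2" by (simp add: e2_eq)
    moreover have "x \<notin> e1" unfolding e1_eq R_def using ae xy \<open>x \<in> e\<close> by auto
    ultimately show ?thesis by blast
  qed
  have idx: "{..length vs - k} = {0, 1, 2}" using len by auto
  have E': "{e1, e, e2} = window k vs ` {..length vs - k}"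
    unfolding idx using w0 w1 w2 by simp
  have V': "set vs = e1 \<union> e \<union> e2"
    using e_eq e1_eq e2_eq r by (auto simp: vs_def)
  have tr: "traces k (set vs) {e1, e, e2} vs"
    unfolding traces_def E' unfolding idx using len w0 w1 w2 ne E by (simp add: inj_on_def)
  have u: "uniform_hypergraph k (set vs) {e1, e, e2}"
    unfolding uniform_hypergraph_def using card_edge E by (simp add: V' fin) blast
  then have s: "subhypergraph k (set vs) {e1, e, e2} V E"
    using E sub V' by (auto simp: subhypergraph_def)
  have "card {e1, e, e2} = 3" using ne E by simp
  moreover have "card {e1, e, e2} \<le> 2" if "is_chain k (set vs) {e1, e, e2}"
    using H s that unfolding two_hypertree_def by blast
  ultimately have "\<not> is_chain k (set vs) {e1, e, e2}" by auto
  moreover have "\<not> is_semicycle k (set vs) {e1, e, e2}"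
    using H s by (auto simp: two_hypertree_def hypertree_def semicycle_free_def)
  ultimately show False
    using tr u by (auto simp: is_chain_def is_semicycle_def)
qed

text \<open>A facet of \<open>e\<close> shared with another edge is unique and becomes
  \<open>t e\<close>. If there is none, any facet serves as \<open>t e\<close>, and the star at it
  is just \<open>{e}\<close>.\<close>

lemma two_hypertree_facet_selection:
  assumes k: "k \<ge> 2" and H: "two_hypertree k V E"
  obtains t where "\<And>e. e \<in> E \<Longrightarrow> t e \<subseteq> e" "\<And>e. e \<in> E \<Longrightarrow> card (t e) = k - 1"
    "\<And>e T. e \<in> E \<Longrightarrow> T \<subseteq> e \<Longrightarrow> card T = k - 1 \<Longrightarrow> T \<noteq> t e \<Longrightarrow> star_at E T = {e}"
proof -
  define good where "good e T \<longleftrightarrow> T \<subseteq> e \<and> card T = k - 1 \<and>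
      (\<forall>T'. T' \<subseteq> e \<longrightarrow> card T' = k - 1 \<longrightarrow> T' \<noteq> T \<longrightarrow> star_at E T' = {e})" for e T
  have "\<exists>T. good e T" if e: "e \<in> E" for e
  proof (cases "\<exists>T. T \<subseteq> e \<and> card T = k - 1 \<and> star_at E T \<noteq> {e}")
    case True
    then obtain T where T: "T \<subseteq> e" "card T = k - 1" "star_at E T \<noteq> {e}" by blast
    then obtain e1 where e1: "e1 \<in> E" "T \<subseteq> e1" "e1 \<noteq> e"
      using e by (auto simp: star_at_def)
    \<comment> \<open>A further edge through \<open>T'\<close> would act as \<open>e2\<close> for
      the pair \<open>T\<close>, \<open>T'\<close> and force \<open>T' = T\<close>.\<close>
    have "star_at E T' = {e}" if T': "T' \<subseteq> e" "card T' = k - 1" "T' \<noteq> T" for T'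
      using two_hypertree_shared_facet_unique[OF k H e e1(1) _ e1(3) _ T(1) e1(2) T(2) T'(1)] T' e
      by (fastforce simp: star_at_def)
    then have "good e T" using T by (simp add: good_def)
    then show ?thesis ..
  next
    case False
    have "card e = k"
      using H e by (simp add: two_hypertree_def hypertree_def uniform_hypergraph_def)
    then obtain T where "T \<subseteq> e" "card T = k - 1"
      using obtain_subset_with_card_n[of "k - 1" e] by (metis diff_le_self)
    then have "good e T" using False by (simp add: good_def)
    then show ?thesis ..
  qed
  then have "\<forall>e\<in>E. \<exists>T. good e T" by simp
  from bchoice[OF this] obtain t where "\<forall>e\<in>E. good e (t e)" ..
  then show ?thesis by (intro that[of t]) (simp_all add: good_def)
qed

section \<open>Maximal stars and their sizes\<close>

text \<open>A star containing \<open>e\<close> whose common set is not \<open>t e\<close> can only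
  be \<open>{e}\<close>. Hence \<open>star_at E (t e)\<close> is the greatest star containing
  \<open>e\<close>, and a maximal star, being nonempty, has this form for each of its edges.\<close>

lemma maximal_star_iff:
  assumes fin: "\<And>e. e \<in> E \<Longrightarrow> finite e"
    and t: "\<And>e. e \<in> E \<Longrightarrow> t e \<subseteq> e" "\<And>e. e \<in> E \<Longrightarrow> card (t e) = k - 1"
    and excl: "\<And>e T. e \<in> E \<Longrightarrow> T \<subseteq> e \<Longrightarrow> card T = k - 1 \<Longrightarrow> T \<noteq> t e \<Longrightarrow> star_at E T = {e}"
  shows "maximal_star k E S \<longleftrightarrow> S \<in> (\<lambda>e. star_at E (t e)) ` E"
proof
  have sub: "S \<subseteq> star_at E (t e)" if S: "is_star k E S" "e \<in> S" for S e
  proof -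
    obtain T where T: "S \<subseteq> E" "card T = k - 1" "\<forall>e\<in>S. T \<subseteq> e"
      using S unfolding is_star_def by blast
    then have S_sub: "S \<subseteq> star_at E T" by (auto simp: star_at_def)
    show ?thesis
    proof (cases "T = t e")
      case False
      have e: "e \<in> E" "T \<subseteq> e" using S(2) T by auto
      then have "S \<subseteq> {e}" using S_sub excl[OF e T(2) False] by simp
      also have "{e} \<subseteq> star_at E (t e)" using e t by (simp add: star_at_def)
      finally show ?thesis .
    qed (use S_sub in simp)
  qed
  have star: "is_star k E (star_at E (t e))" and mem: "e \<in> star_at E (t e)" if "e \<in> E" for e
  proof -
    show mem: "e \<in> star_at E (t e)" using that t by (simp add: star_at_def)
    have "finite (t e)" using t fin that finite_subset by metis
    then show "is_star k E (star_at E (t e))"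
      using mem t(2)[OF that] unfolding is_star_def by (auto simp: star_at_def)
  qed
  show "S \<in> (\<lambda>e. star_at E (t e)) ` E" if S: "maximal_star k E S"
  proof -
    obtain e where e: "e \<in> S" "e \<in> E"
      using S by (auto simp: maximal_star_def is_star_def)
    have "S \<subseteq> star_at E (t e)" using S e sub by (simp add: maximal_star_def)
    then have "S = star_at E (t e)"
      using S star[OF e(2)] by (auto simp: maximal_star_def)
    then show ?thesis using e by simp
  qed
  show "maximal_star k E S" if S: "S \<in> (\<lambda>e. star_at E (t e)) ` E"
  proof -
    obtain e where e: "e \<in> E" "S = star_at E (t e)" using S by auto
    have "\<not> S \<subset> S'" if S': "is_star k E S'" for S'
    proof
      assume "S \<subset> S'"
      moreover from this have "S' \<subseteq> S" using sub[OF S'] mem e by auto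
      ultimately show False by simp
    qed
    then show ?thesis using star e by (auto simp: maximal_star_def)
  qed
qed

text \<open>An edge through a fixed \<open>(k - 1)\<close>-set \<open>T\<close> is determined by its
  one vertex outside \<open>T\<close>, which leaves \<open>card V - (k - 1)\<close> choices. Writing
  this as \<open>card V + 1 - k\<close> avoids the early truncation of
  \<open>card V - k + 1\<close>.\<close>

lemma card_maximal_star_bounds:
  assumes U: "uniform_hypergraph k V E" and k: "k \<ge> 1" and S: "maximal_star k E S"
  shows "card S \<in> {1..card V + 1 - k}"
proof -
  obtain T where T: "S \<noteq> {}" "S \<subseteq> E" "finite T" "card T = k - 1" "\<forall>e\<in>S. T \<subseteq> e"
    using S unfolding maximal_star_def is_star_def by blast
  have E: "e \<subseteq> V" "card e = k" if "e \<in> E" for e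
    using U that by (auto simp: uniform_hypergraph_def)
  have "finite V" using U by (simp add: uniform_hypergraph_def)
  obtain e0 where "e0 \<in> S" using T(1) by blast
  then have "e0 \<in> E" "T \<subseteq> e0" using T by blast+
  then have "T \<subseteq> V" using E by blast
  have "S \<subseteq> (\<lambda>x. insert x T) ` (V - T)"
  proof
    fix e assume "e \<in> S"
    then have e: "e \<in> E" "T \<subseteq> e" using T by auto
    then have "finite e" using E[OF e(1)] \<open>finite V\<close> finite_subset by metis
    then obtain x where x: "x \<notin> T" "e = insert x T"
      using insert_of_Suc_card[of T e] e(2) E[OF e(1)] T(4) k by auto
    then show "e \<in> (\<lambda>x. insert x T) ` (V - T)" using E[OF e(1)] by simp
  qed
  then have "card S \<le> card (V - T)" and "finite S"
    using \<open>finite V\<close> by (auto intro: surj_card_le finite_subset)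
  moreover have "card (V - T) = card V + 1 - k"
    using T \<open>T \<subseteq> V\<close> k by (simp add: card_Diff_subset)
  moreover have "0 < card S" using \<open>finite S\<close> T by (simp add: card_gt_0_iff)
  ultimately show ?thesis by simp
qed

text \<open>By the size bounds the range of summation misses no maximal star, so grouping by size
  counts each of them once.\<close>

lemma sum_num_maximal_stars:
  assumes U: "uniform_hypergraph k V E" and k: "k \<ge> 1"
  shows "(\<Sum>i = 1..card V + 1 - k. num_maximal_stars k E i) = card {S. maximal_star k E S}"
proof -
  have "E \<subseteq> Pow V" "finite V" using U by (auto simp: uniform_hypergraph_def)
  then have "finite E" using finite_subset by blast
  have fin: "finite {S. maximal_star k E S}"
    by (rule finite_subset[of _ "Pow E"])
      (use \<open>finite E\<close> in \<open>auto simp: maximal_star_def is_star_def\<close>)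
  have "card {S. maximal_star k E S} =
      card (\<Union>i\<in>{1..card V + 1 - k}. {S. maximal_star k E S \<and> card S = i})"
    using card_maximal_star_bounds[OF U k] by (intro arg_cong[of _ _ card]) auto
  also have "\<dots> = (\<Sum>i = 1..card V + 1 - k. num_maximal_stars k E i)"
    unfolding num_maximal_stars_def
    by (rule card_UN_disjoint) (auto intro: finite_subset[OF _ fin])
  finally show ?thesis by simp
qed

section \<open>Counting the covered and uncovered sets\<close>

lemma card_covered_plus_uncovered:
  assumes "finite V"
  shows "card {T. T \<subseteq> V \<and> card T = k - 1 \<and> (\<exists>e\<in>E. T \<subseteq> e)} + num_uncovered k V E
    = card V choose (k - 1)"
proof -
  have "card V choose (k - 1) = card {T. T \<subseteq> V \<and> card T = k - 1}"
    using n_subsets[OF assms] by simp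
  also have "\<dots> = card ({T. T \<subseteq> V \<and> card T = k - 1 \<and> (\<exists>e\<in>E. T \<subseteq> e)} \<union>
      {T. T \<subseteq> V \<and> card T = k - 1 \<and> \<not> (\<exists>e\<in>E. T \<subseteq> e)})"
    by (rule arg_cong[of _ _ card]) blast
  also have "\<dots> = card {T. T \<subseteq> V \<and> card T = k - 1 \<and> (\<exists>e\<in>E. T \<subseteq> e)} + num_uncovered k V E"
    unfolding num_uncovered_def
    by (rule card_Un_disjoint) (use assms in \<open>auto intro: finite_subset[of _ "Pow V"]\<close>)
  finally show ?thesis by simp
qed

text \<open>Edges with the same selected facet share one maximal star, so the selected facets are
  counted as the image of \<open>E\<close> under \<open>t\<close>. The private facets are counted
  edge by edge, \<open>k - 1\<close> of the \<open>k\<close> facets each.\<close>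

lemma two_hypertree_card_covered:
  assumes k: "k \<ge> 2" and H: "two_hypertree k V E"
  shows "card {T. T \<subseteq> V \<and> card T = k - 1 \<and> (\<exists>e\<in>E. T \<subseteq> e)}
    = card {S. maximal_star k E S} + card E * (k - 1)"
proof -
  obtain t where t: "\<And>e. e \<in> E \<Longrightarrow> t e \<subseteq> e" "\<And>e. e \<in> E \<Longrightarrow> card (t e) = k - 1"
    and excl: "\<And>e T. e \<in> E \<Longrightarrow> T \<subseteq> e \<Longrightarrow> card T = k - 1 \<Longrightarrow> T \<noteq> t e \<Longrightarrow> star_at E T = {e}"
    using two_hypertree_facet_selection[OF k H] by blast
  have U: "finite V" "e \<in> E \<Longrightarrow> e \<subseteq> V" "e \<in> E \<Longrightarrow> card e = k" for e
    using H by (auto simp: two_hypertree_def hypertree_def uniform_hypergraph_def)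
  have finE: "finite E" using U by (meson PowI finite_Pow_iff finite_subset subsetI)
  have fin: "finite e" if "e \<in> E" for e using U that finite_subset by blast
  define P where "P e = {T. T \<subseteq> e \<and> card T = k - 1} - {t e}" for e
  have finP: "finite (P e)" if "e \<in> E" for e
    using fin[OF that] by (simp add: P_def)
  have cardP: "card (P e) = k - 1" if "e \<in> E" for e
  proof -
    have "card {T. T \<subseteq> e \<and> card T = k - 1} = k choose (k - 1)"
      using n_subsets[of e "k - 1"] fin U that by simp
    also have "\<dots> = k" using k binomial_symmetric[of 1 k] by simp
    finally show ?thesis
      using t that by (simp add: P_def card_Diff_singleton)
  qed
  have P_star: "star_at E T = {e}" if "e \<in> E" "T \<in> P e" for e T
    using that excl by (auto simp: P_def)
  have "{T. T \<subseteq> V \<and> card T = k - 1 \<and> (\<exists>e\<in>E. T \<subseteq> e)} = t ` E \<union> (\<Union>e\<in>E. P e)"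
  proof (intro set_eqI iffI)
    fix T assume "T \<in> {T. T \<subseteq> V \<and> card T = k - 1 \<and> (\<exists>e\<in>E. T \<subseteq> e)}"
    then show "T \<in> t ` E \<union> (\<Union>e\<in>E. P e)" by (auto simp: P_def)
  next
    fix T assume "T \<in> t ` E \<union> (\<Union>e\<in>E. P e)"
    then obtain e where "e \<in> E" "T \<subseteq> e" "card T = k - 1"
      using t by (auto simp: P_def)
    then show "T \<in> {T. T \<subseteq> V \<and> card T = k - 1 \<and> (\<exists>e\<in>E. T \<subseteq> e)}"
      using U(2)[of e] by auto
  qed
  \<comment> \<open>A selected facet \<open>t e\<close> lies in \<open>e\<close>. If it were private
    to \<open>e'\<close>, then \<open>e = e'\<close>, but \<open>P e\<close> omits
    \<open>t e\<close>.\<close>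
  moreover have "t ` E \<inter> (\<Union>e\<in>E. P e) = {}"
  proof (rule ccontr)
    assume "t ` E \<inter> (\<Union>e\<in>E. P e) \<noteq> {}"
    then obtain e e' where e: "e \<in> E" "e' \<in> E" "t e \<in> P e'" by blast
    then have "e \<in> star_at E (t e)" using t by (simp add: star_at_def)
    then have "e = e'" using P_star[OF e(2,3)] by simp
    then show False using e by (simp add: P_def)
  qed
  moreover have "card (\<Union>e\<in>E. P e) = card E * (k - 1)"
  proof -
    have "card (\<Union>e\<in>E. P e) = (\<Sum>e\<in>E. card (P e))"
    proof (rule card_UN_disjoint)
      show "\<forall>e\<in>E. \<forall>e'\<in>E. e \<noteq> e' \<longrightarrow> P e \<inter> P e' = {}"
      proof (intro ballI impI equals0I)
        fix e e' T assume e: "e \<in> E" "e' \<in> E" "e \<noteq> e'" "T \<in> P e \<inter> P e'"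
        then have "{e} = {e'}" using P_star[of e T] P_star[of e' T] by simp
        then show False using e(3) by simp
      qed
    qed (use finE finP in simp_all)
    then show ?thesis using cardP by simp
  qed
  moreover have "card {S. maximal_star k E S} = card (t ` E)"
  proof -
    have "{S. maximal_star k E S} = star_at E ` t ` E"
      using maximal_star_iff[of E t k, OF fin t excl] by auto
    \<comment> \<open>If different facets \<open>t e\<close> and \<open>t e'\<close> had the same
      star, \<open>t e'\<close> would be a facet of \<open>e\<close> other than \<open>t e\<close>.
      The star would then be \<open>{e}\<close>, and as it contains \<open>e'\<close>, this gives
      \<open>e = e'\<close>.\<close>
    moreover have "inj_on (star_at E) (t ` E)"
    proof (rule inj_onI, elim imageE, simp)
      fix e e' assume e: "e \<in> E" "e' \<in> E" "star_at E (t e) = star_at E (t e')"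
      show "t e = t e'"
      proof (rule ccontr)
        assume ne: "t e \<noteq> t e'"
        have "e \<in> star_at E (t e')" using e t by (auto simp: star_at_def)
        then have "t e' \<subseteq> e" by (simp add: star_at_def)
        then have "star_at E (t e') = {e}"
          using excl e t ne by metis
        moreover have "e' \<in> star_at E (t e')" using e t by (auto simp: star_at_def)
        ultimately show False using ne by simp
      qed
    qed
    ultimately show ?thesis by (simp add: card_image)
  qed
  ultimately show ?thesis
    using finE finP by (simp add: card_Un_disjoint)
qed

theorem theorem5:
  fixes V :: "'a set" and E :: "'a set set" and k n :: nat
  assumes "k \<ge> 2"
    and "two_hypertree k V E"
    and "n = card V"
  shows "real (card E) =
      1 / (real k - 1) * real (n choose (k - 1))
    - 1 / (real k - 1) * (\<Sum>i = 1..n + 1 - k. real (num_maximal_stars k E i))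
    - real (num_uncovered k V E) / (real k - 1)"
proof -
  have U: "uniform_hypergraph k V E"
    using assms by (simp add: two_hypertree_def hypertree_def)
  then have "finite V" by (simp add: uniform_hypergraph_def)
  have stars: "(\<Sum>i = 1..n + 1 - k. real (num_maximal_stars k E i))
      = real (card {S. maximal_star k E S})"
    using sum_num_maximal_stars[OF U] assms by (simp flip: of_nat_sum)
  \<comment> \<open>The count is kept additive over the naturals and solved for
    \<open>card E\<close> only over the reals, where \<open>k \<ge> 2\<close> makes the divisor
    nonzero.\<close>
  have "card {S. maximal_star k E S} + card E * (k - 1) + num_uncovered k V E = n choose (k - 1)"
    using card_covered_plus_uncovered[OF \<open>finite V\<close>, of k E]
      two_hypertree_card_covered[OF assms(1,2)] assms(3) by simp
  then have "real (n choose (k - 1)) = real (card {S. maximal_star k E S})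
      + real (card E) * real (k - 1) + real (num_uncovered k V E)"
    by (simp only: flip: of_nat_add of_nat_mult)
  moreover have "real (k - 1) = real k - 1" "real k - 1 \<noteq> 0" using assms(1) by auto
  ultimately have "real (card E) = (real (n choose (k - 1)) - real (card {S. maximal_star k E S})
      - real (num_uncovered k V E)) / (real k - 1)"
    by (simp add: eq_divide_eq)
  then show ?thesis
    unfolding stars by (simp add: diff_divide_distrib)
qed

end
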